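(* Let $q$ be a power of an odd prime. There exist a positive integer $n$ satisfying $$n \le \left\lceil \frac{\log q}{\log 2} \right\rceil$$ and some pairwise distinct $a_1, \ldots, a_n \in \mathbb{F}_q$ such that the directed graph $\mathcal{G}(X^2+a_1, \ldots, X^2+a_n)$ has no leaf.
   Context: $\mathbb{F}_q$ is the finite field of $q$ elements. For polynomials $f_1,\ldots,f_n \in \mathbb{F}_q[X]$, $\mathcal{G}(f_1,\ldots,f_n)$ is the directed graph with nodes labelled by the elements of $\mathbb{F}_q$ and with an edge from $u$ to $v$ ($u,v\in\mathbb{F}_q$) if and only if $f_i(u)=v$ for some $i=1,\ldots,n$. A leaf is a vertex of in-degree $0$. *)

theory Defs
  imports
    Complex_Main
    "HOL-Library.Cardinality"
    "HOL-Computational_Algebra.Polynomial"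
    "HOL-Computational_Algebra.Primes"
    "Graph_Theory.Digraph"
begin

text \<open>
  An arc is the pair of its ends, so several polynomials sending \<open>u\<close> to \<open>v\<close> give a single arc;
  loops are allowed.
\<close>

definition func_graph :: "'a::{field,finite} poly list \<Rightarrow> ('a, 'a \<times> 'a) pre_digraph" where
  "func_graph fs =
     \<lparr> verts = UNIV, arcs = {(u, v). \<exists>f \<in> set fs. poly f u = v}, tail = fst, head = snd \<rparr>"

text \<open>
  The library's \<^const>\<open>in_degree\<close> is a \<^const>\<open>card\<close>, which is also 0 on infinite sets; this
  notion of leaf is therefore meant for finite digraphs.
\<close>

definition is_leaf :: "('a, 'b) pre_digraph \<Rightarrow> 'a \<Rightarrow> bool" where
  "is_leaf G v \<longleftrightarrow> v \<in> verts G \<and> in_degree G v = 0"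

end

theory Submission
  imports Defs
begin

text \<open>
  A vertex \<open>v\<close> has an incoming arc exactly when \<open>v - c\<close> is a square for one of the chosen
  constants \<open>c\<close>, so the graph has no leaf iff the translates by these constants of the set \<open>S\<close> of
  squares cover the field. Squaring is at most two-to-one, hence \<open>S\<close> contains at least half of the
  field (\<open>card_le_twice_card_squares\<close>).

  The translates of such a set are chosen greedily. Whatever set \<open>U\<close> is still uncovered, a random
  translate of \<open>S\<close> contains on average a proportion \<open>card S / q \<ge> 1 / 2\<close> of it, so some
  translate covers at least half of \<open>U\<close> (\<open>exists_translate_covering_half\<close>). After \<open>n\<close> choices at
  most \<open>q / 2 ^ n\<close> elements remain, which means none once \<open>2 ^ n > q\<close>
  (\<open>few_translates_cover\<close>). For \<open>n = \<lceil>log 2 q\<rceil>\<close> the bound \<open>2 ^ n \<ge> q\<close> is automatic, and it is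
  strict because \<open>q > 1\<close> is odd.
\<close>

text \<open>
  Counting the pairs \<open>(a, u)\<close> with \<open>u \<in> U\<close> and \<open>u - a \<in> S\<close> by their second component gives
  \<open>card U * card S\<close>, because \<open>a \<mapsto> u - a\<close> is a bijection of the group; the claim is that the best
  \<open>a\<close> is at least as good as the average.
\<close>
lemma exists_translate_covering_half:
  fixes S U :: "'a::{ab_group_add,finite} set"
  assumes "CARD('a) \<le> 2 * card S"
  obtains a where "card U \<le> 2 * card {u \<in> U. u - a \<in> S}"
proof -
  have fibre: "card {a. u - a \<in> S} = card S" for u :: 'a
    by (rule bij_betw_same_card[of "\<lambda>a. u - a"], rule bij_betw_byWitness[of _ "\<lambda>s. u - s"]) auto
  have "(\<Sum>a\<in>UNIV. card {u \<in> U. u - a \<in> S}) = (\<Sum>u\<in>U. card {a \<in> UNIV. u - a \<in> S})"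
    by (rule sum_multicount_gen[symmetric]) auto
  then have pairs: "(\<Sum>a\<in>UNIV. card {u \<in> U. u - a \<in> S}) = card U * card S"
    by (simp add: fibre)
  have "\<exists>a. card U \<le> 2 * card {u \<in> U. u - a \<in> S}"
  proof (rule ccontr)
    assume "\<not> ?thesis"
    then have "(\<Sum>a\<in>UNIV. 2 * card {u \<in> U. u - a \<in> S}) < (\<Sum>a\<in>(UNIV::'a set). card U)"
      by (intro sum_strict_mono) (auto simp: not_le)
    then have "card U * (2 * card S) < card U * CARD('a)"
      by (simp add: sum_distrib_left[symmetric] pairs mult.commute mult.left_commute)
    with assms show False
      by simp
  qed
  then show ?thesis
    using that by blast
qed

text \<open>The greedy choice: each further translate at least halves the uncovered set.\<close>
lemma translates_leave_few_uncovered: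
  fixes S :: "'a::{ab_group_add,finite} set"
  assumes "CARD('a) \<le> 2 * card S"
  shows "\<exists>A. card A \<le> n \<and> 2 ^ n * card {v. \<forall>a\<in>A. v - a \<notin> S} \<le> CARD('a)"
proof (induction n)
  case 0
  show ?case
    by (intro exI[of _ "{}"]) simp
next
  case (Suc n)
  then obtain A where A: "card A \<le> n" "2 ^ n * card {v. \<forall>a\<in>A. v - a \<notin> S} \<le> CARD('a)"
    by blast
  define U where "U = {v. \<forall>a\<in>A. v - a \<notin> S}"
  obtain b where b: "card U \<le> 2 * card {u \<in> U. u - b \<in> S}"
    using exists_translate_covering_half[OF assms] .
  have "{v. \<forall>a\<in>insert b A. v - a \<notin> S} = U - {u \<in> U. u - b \<in> S}"
    by (auto simp: U_def)
  then have "2 * card {v. \<forall>a\<in>insert b A. v - a \<notin> S} \<le> card U"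
    using b by (simp add: card_Diff_subset)
  then have "2 ^ n * (2 * card {v. \<forall>a\<in>insert b A. v - a \<notin> S}) \<le> 2 ^ n * card U"
    by (rule mult_left_mono) simp
  also have "\<dots> \<le> CARD('a)"
    using A(2) by (simp add: U_def)
  finally have "2 ^ Suc n * card {v. \<forall>a\<in>insert b A. v - a \<notin> S} \<le> CARD('a)"
    by (simp add: mult.assoc mult.left_commute)
  moreover have "card (insert b A) \<le> Suc n"
    using A(1) by (simp add: card_insert_if)
  ultimately show ?case
    by blast
qed

lemma few_translates_cover:
  fixes S :: "'a::{ab_group_add,finite} set"
  assumes "CARD('a) \<le> 2 * card S" and "CARD('a) < 2 ^ n"
  obtains A where "card A \<le> n" and "\<And>v. \<exists>a\<in>A. v - a \<in> S"
proof -
  obtain A where A: "card A \<le> n" "2 ^ n * card {v. \<forall>a\<in>A. v - a \<notin> S} \<le> CARD('a)"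
    using translates_leave_few_uncovered[OF assms(1)] by blast
  with assms(2) have "2 ^ n * card {v. \<forall>a\<in>A. v - a \<notin> S} < 2 ^ n * 1"
    by linarith
  then have "card {v. \<forall>a\<in>A. v - a \<notin> S} = 0"
    by (subst (asm) mult_less_cancel1) linarith
  then have "{v. \<forall>a\<in>A. v - a \<notin> S} = {}"
    by simp
  then have "\<exists>a\<in>A. v - a \<in> S" for v
    by blast
  then show ?thesis
    by (rule that[OF A(1)])
qed

text \<open>Every fibre of squaring is contained in some \<open>{x, - x}\<close>.\<close>
lemma card_le_twice_card_squares:
  "CARD('a::{idom,finite}) \<le> 2 * card (range (\<lambda>x::'a. x ^ 2))"
proof -
  have "card {x \<in> (UNIV :: 'a set). x ^ 2 = y} \<le> 2" if "y \<in> range (\<lambda>x::'a. x ^ 2)" for y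
  proof -
    from that obtain z where "y = z ^ 2"
      by (rule rangeE)
    then have "{x \<in> UNIV. x ^ 2 = y} \<subseteq> {z, - z}"
      by (auto simp: power2_eq_iff)
    then have "card {x \<in> UNIV. x ^ 2 = y} \<le> card {z, - z}"
      by (intro card_mono) auto
    also have "\<dots> \<le> 2"
      by (simp add: card_insert_if)
    finally show ?thesis .
  qed
  then have "(\<Sum>y\<in>range (\<lambda>x::'a. x ^ 2). card {x \<in> (UNIV :: 'a set). x ^ 2 = y})
      \<le> (\<Sum>y\<in>range (\<lambda>x::'a. x ^ 2). 2)"
    by (intro sum_mono)
  moreover have "(\<Sum>y\<in>range (\<lambda>x::'a. x ^ 2). card {x \<in> (UNIV :: 'a set). x ^ 2 = y})
      = (\<Sum>x\<in>(UNIV :: 'a set). card {y \<in> range (\<lambda>x::'a. x ^ 2). x ^ 2 = y})"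
    by (rule sum_multicount_gen[symmetric]) auto
  moreover have "{y \<in> range (\<lambda>x::'a. x ^ 2). x ^ 2 = y} = {x ^ 2}" for x :: 'a
    by auto
  ultimately show ?thesis
    by simp
qed

lemma is_leaf_shifted_squares_iff:
  fixes v :: "'a::{field,finite}"
  shows "is_leaf (func_graph (map (\<lambda>c. monom 1 2 + [:c:]) cs)) v \<longleftrightarrow>
    (\<forall>c\<in>set cs. v - c \<notin> range (\<lambda>x. x ^ 2))"
proof -
  have "is_leaf (func_graph (map (\<lambda>c. monom 1 2 + [:c:]) cs)) v \<longleftrightarrow>
      (\<forall>c\<in>set cs. \<forall>u. u ^ 2 + c \<noteq> v)"
    by (auto simp: is_leaf_def in_degree_def in_arcs_def func_graph_def poly_monom)
  also have "\<dots> \<longleftrightarrow> (\<forall>c\<in>set cs. v - c \<notin> range (\<lambda>x. x ^ 2))"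
    by (simp add: image_iff diff_eq_eq eq_commute[of v])
  finally show ?thesis .
qed

theorem theorem2p3:
  fixes p k q :: nat
  assumes "prime p" and "odd p" and "k \<ge> 1" and "q = p ^ k"
    and "CARD('a::{field,finite}) = q"
  shows "\<exists>(n::nat) (a :: 'a list).
           n \<ge> 1 \<and> int n \<le> \<lceil>ln (real q) / ln 2\<rceil> \<and>
           length a = n \<and> distinct a \<and>
           \<not> (\<exists>v. is_leaf (func_graph (map (\<lambda>c. monom 1 2 + [:c:]) a)) v)"
proof -
  have "odd q"
    using assms by simp
  have "q > 1"
    using assms prime_gt_1_nat[of p] one_less_power[of p k] by simp
  define m where "m = nat \<lceil>log 2 (real q)\<rceil>"
  have "log 2 (real q) > 0"
    using \<open>q > 1\<close> by simp
  then have m: "int m = \<lceil>log 2 (real q)\<rceil>" and "m > 0"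
    by (simp_all add: m_def)
  have "log 2 (real q) \<le> real m"
    by (simp add: m_def real_nat_ceiling_ge)
  then have "real q \<le> 2 powr real m"
    using \<open>q > 1\<close> by (simp add: log_le_iff)
  then have "real q \<le> real (2 ^ m)"
    by (simp add: powr_realpow)
  then have "q \<le> 2 ^ m"
    by (simp only: of_nat_le_iff)
  moreover have "q \<noteq> 2 ^ m"
    using \<open>odd q\<close> \<open>m > 0\<close> by auto
  ultimately have "CARD('a) < 2 ^ m"
    using assms by simp
  with card_le_twice_card_squares obtain A :: "'a set"
    where A: "card A \<le> m" "\<And>v. \<exists>a\<in>A. v - a \<in> range (\<lambda>x. x ^ 2)"
    using few_translates_cover[where 'a = 'a] by blast
  obtain cs where cs: "set cs = A" "distinct cs"
    using finite_distinct_list[of A] by auto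
  have "length cs = card A"
    using cs distinct_card by fastforce
  moreover have "A \<noteq> {}"
    using A(2) by blast
  ultimately have "length cs \<ge> 1"
    by (simp add: Suc_le_eq card_gt_0_iff)
  moreover have "int (length cs) \<le> \<lceil>ln (real q) / ln 2\<rceil>"
    using \<open>length cs = card A\<close> A(1) m by (simp add: log_def)
  moreover have "\<not> (\<exists>v. is_leaf (func_graph (map (\<lambda>c. monom 1 2 + [:c:]) cs)) v)"
    using A(2) cs(1) by (simp add: is_leaf_shifted_squares_iff)
  ultimately show ?thesis
    using cs(2) by blast
qed

end
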